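(* Consider the learning-augmented secretary problem with $n=3$ candidates. For every $\delta>0$ there exist a prediction vector $(\widehat v_1,\widehat v_2,\widehat v_3)$ of positive reals and a finite set $\mathcal V$ of true value vectors $(v_1,v_2,v_3)$ of positive reals, with $(\widehat v_1,\widehat v_2,\widehat v_3)\in\mathcal V$ and with all entries constants depending only on $\delta$, such that every (deterministic or randomized) online algorithm that is $1$-consistent has, on some $(v_1,v_2,v_3)\in\mathcal V$ given together with the prediction $(\widehat v_1,\widehat v_2,\widehat v_3)$, expected competitive ratio at most $\frac13+\delta$. In particular, no $1$-consistent algorithm is $\rho$-robust for any $\rho>\frac13+\delta$; and for suitable choices no $1$-consistent algorithm is $\frac1e$-robust.
   Context: Secretary problem with predictions: there are $n$ candidates $1,\dots,n$ with true values $v_1,\dots,v_n\ge 0$; before any arrival the algorithm receives predictions $\widehat v_1,\dots,\widehat v_n$ of these values. The candidates arrive one at a time in a uniformly random order. When candidate $i$ arrives, the algorithm learns its identity $i$ and its value $v_i$, and must irrevocably either reject it or accept it; accepting ends the process with reward $r=v_i$ (reward $0$ if no one is accepted). The algorithm may use internal randomness. Its competitive ratio on an instance (true values and predictions) is $\mathbb E[r]/v^*$, where $v^*=\max_i v_i$ and the expectation is over the random arrival order and the algorithm's randomness. An algorithm is $1$-consistent if its competitive ratio equals $1$ on every instance where the predictions are exactly correct, i.e. $\widehat v_i=v_i$ for all $i$. An algorithm is $\rho$-robust if its competitive ratio is at least $\rho$ on every instance, for arbitrary (possibly wrong) predictions. *)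

theory Defs
  imports "HOL-Probability.Probability" "HOL-Combinatorics.Multiset_Permutations"
begin

text \<open>
  The candidates are the elements of a finite type; a vector in \<open>real ^ 'n\<close> holds one value
  per candidate. A deterministic algorithm sees the predictions and the history of arrivals
  (identity and value, in order of arrival, the current candidate last) and decides whether to
  accept the current candidate.
\<close>

type_synonym 'n policy = "real ^ 'n \<Rightarrow> ('n \<times> real) list \<Rightarrow> bool"

primrec reward_from ::
  "('n::finite) policy \<Rightarrow> real ^ 'n \<Rightarrow> real ^ 'n \<Rightarrow> ('n \<times> real) list \<Rightarrow> 'n list \<Rightarrow> real"
where
  "reward_from A p v h [] = 0"
| "reward_from A p v h (i # is) =
     (if A p (h @ [(i, v $ i)]) then v $ i else reward_from A p v (h @ [(i, v $ i)]) is)"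

definition reward :: "('n::finite) policy \<Rightarrow> real ^ 'n \<Rightarrow> real ^ 'n \<Rightarrow> 'n list \<Rightarrow> real" where
  "reward A p v = reward_from A p v []"

text \<open>
  A (randomized) algorithm is a probability measure on policies for which every single decision
  is an event. This is fully general: internal randomness from any probability space can be
  pushed forward to policies. Deterministic algorithms are the point masses.
\<close>

definition online_algorithm :: "('n::finite) policy measure \<Rightarrow> bool" where
  "online_algorithm M \<longleftrightarrow>
     prob_space M \<and> (\<forall>p h. {A \<in> space M. A p h} \<in> sets M)"

lemma online_algorithm_return: "online_algorithm (return (count_space UNIV) A)"
  by (simp add: online_algorithm_def prob_space_return)

definition arrival_order :: "('n::finite) list pmf" where
  "arrival_order = pmf_of_set (permutations_of_set UNIV)"

definition expected_reward ::
  "('n::finite) policy measure \<Rightarrow> real ^ 'n \<Rightarrow> real ^ 'n \<Rightarrow> real"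
where
  "expected_reward M p v =
     (\<integral>A. measure_pmf.expectation arrival_order (reward A p v) \<partial>M)"

lemma expected_reward_return:
  "expected_reward (return (count_space UNIV) A) p v =
     measure_pmf.expectation arrival_order (reward A p v)"
  unfolding expected_reward_def by (subst integral_return) auto

definition best_value :: "real ^ ('n::finite) \<Rightarrow> real" where
  "best_value v = Max (range (\<lambda>i. v $ i))"

definition competitive_ratio ::
  "('n::finite) policy measure \<Rightarrow> real ^ 'n \<Rightarrow> real ^ 'n \<Rightarrow> real"
where
  "competitive_ratio M p v = expected_reward M p v / best_value v"

text \<open>
  The all-zero vector is excluded because the competitive ratio is undefined there; with
  \<open>0 / 0 = 0\<close> it would make consistency and robustness unsatisfiable.
\<close>

definition true_values :: "(real ^ ('n::finite)) set" where
  "true_values = {v. (\<forall>i. 0 \<le> v $ i) \<and> 0 < best_value v}"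

definition one_consistent :: "('n::finite) policy measure \<Rightarrow> bool" where
  "one_consistent M \<longleftrightarrow> (\<forall>v \<in> true_values. competitive_ratio M v v = 1)"

definition robust :: "real \<Rightarrow> ('n::finite) policy measure \<Rightarrow> bool" where
  "robust \<rho> M \<longleftrightarrow> (\<forall>p. \<forall>v \<in> true_values. \<rho> \<le> competitive_ratio M p v)"

end

theory Submission
  imports Defs
begin

text \<open>
  Let candidate 1 have the correct value 1, predicted to be strictly largest. A 1-consistent
  algorithm accepts it almost surely whenever it arrives first. Give candidates 2 and 3
  the values \<open>L ^ k\<close> and \<open>L ^ (k + 1)\<close> (in an order depending on the parity of \<open>k\<close>) for a large
  \<open>L\<close>. Only accepting the best candidate matters, and if \<open>f k\<close> denotes the probability of
  accepting the value \<open>L ^ k\<close> on first arrival, then the competitive ratio is at most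
  \<open>1 / L + (1 + f (k + 1) - f k) / 3\<close>: the best candidate is missed if candidate 1 comes first, and
  also if the second best comes first and is accepted. As the prefix with value \<open>L ^ (k + 1)\<close> is
  shared by the \<open>k\<close>-th and the \<open>(k + 1)\<close>-st instance, a ratio above \<open>1 / 3 + \<delta>\<close> on all instances
  forces \<open>f\<close> to grow by a fixed amount at every step, which contradicts \<open>f \<le> 1\<close>.
\<close>

section \<open>Expectation, bounds and integrability of rewards\<close>

lemma expectation_arrival_order_3:
  fixes f :: "('n::finite) list \<Rightarrow> real"
  assumes U: "(UNIV :: 'n set) = {a, b, c}" and d: "a \<noteq> b" "a \<noteq> c" "b \<noteq> c"
  shows "measure_pmf.expectation arrival_order f =
    (f [a, b, c] + f [a, c, b] + f [b, a, c] + f [b, c, a] + f [c, a, b] + f [c, b, a]) / 6"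
proof -
  have "permutations_of_set (UNIV :: 'n set) =
      {[a, b, c], [a, c, b], [b, a, c], [b, c, a], [c, a, b], [c, b, a]}" (is "_ = ?P")
  proof (rule sym, rule card_subset_eq)
    show "?P \<subseteq> permutations_of_set (UNIV :: 'n set)"
      using d by (auto simp: permutations_of_set_def U)
    have "card (UNIV :: 'n set) = 3"
      using d by (simp add: U)
    then show "card ?P = card (permutations_of_set (UNIV :: 'n set))"
      using d by (simp add: fact_numeral)
  qed simp
  then show ?thesis
    unfolding arrival_order_def using d by (subst integral_pmf_of_set) auto
qed

lemma reward_from_nonneg:
  assumes "\<forall>i. 0 \<le> v $ i"
  shows "0 \<le> reward_from A p v h is"
  using assms by (induction "is" arbitrary: h) auto

lemma reward_from_le:
  assumes "\<forall>i \<in> set is. v $ i \<le> B" and "0 \<le> B"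
  shows "reward_from A p v h is \<le> B"
  using assms by (induction "is" arbitrary: h) auto

lemma reward_nonneg: "\<forall>i. 0 \<le> v $ i \<Longrightarrow> 0 \<le> reward A p v is"
  by (simp add: reward_def reward_from_nonneg)

lemma reward_le: "\<forall>i \<in> set is. v $ i \<le> B \<Longrightarrow> 0 \<le> B \<Longrightarrow> reward A p v is \<le> B"
  by (simp add: reward_def reward_from_le)

text \<open>Only the first decision is tracked; whatever follows a rejection is bounded crudely by
  \<open>B\<close>.\<close>

lemma reward_Cons_le:
  assumes "\<forall>i \<in> set is. v $ i \<le> B" "0 \<le> B"
  shows "reward A p v (i # is) \<le> (if A p [(i, v $ i)] then v $ i else B)"
  using assms by (simp add: reward_def reward_from_le)

lemma reward_from_measurable:
  assumes "online_algorithm M"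
  shows "(\<lambda>A. reward_from A p v h is) \<in> borel_measurable M"
proof (induction "is" arbitrary: h)
  case (Cons i "is")
  have "{A \<in> space M. A p (h @ [(i, v $ i)])} \<in> sets M"
    using assms by (simp add: online_algorithm_def)
  then show ?case
    by (simp add: measurable_If Cons.IH)
qed simp

lemma mean_reward_bounds:
  fixes v :: "real ^ ('n::finite)"
  assumes "\<forall>i. 0 \<le> v $ i" "\<forall>i. v $ i \<le> B"
  shows "measure_pmf.expectation arrival_order (reward A p v) \<in> {0..B}"
proof -
  have B: "0 \<le> B"
    using assms order_trans by blast
  have "finite (set_pmf (arrival_order :: 'n list pmf))"
    by (simp add: arrival_order_def)
  then have int: "integrable (measure_pmf (arrival_order :: 'n list pmf)) f"
    for f :: "'n list \<Rightarrow> real"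
    by (rule integrable_measure_pmf_finite)
  have "measure_pmf.expectation arrival_order (reward A p v) \<le>
      measure_pmf.expectation (arrival_order :: 'n list pmf) (\<lambda>_. B)"
    by (rule integral_mono[OF int int]) (use assms B in \<open>simp add: reward_le\<close>)
  moreover have "0 \<le> measure_pmf.expectation arrival_order (reward A p v)"
    using assms by (intro integral_nonneg_AE) (simp add: reward_nonneg)
  ultimately show ?thesis
    by simp
qed

lemma mean_reward_integrable:
  fixes v :: "real ^ ('n::finite)"
  assumes M: "online_algorithm M" and v: "\<forall>i. 0 \<le> v $ i"
  shows "integrable M (\<lambda>A. measure_pmf.expectation arrival_order (reward A p v))"
proof -
  interpret prob_space M
    using M by (simp add: online_algorithm_def)
  have "(\<lambda>A. reward A p v is) \<in> borel_measurable M" for "is"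
    by (simp add: reward_def reward_from_measurable M)
  then have "(\<lambda>A. measure_pmf.expectation arrival_order (reward A p v)) \<in> borel_measurable M"
    unfolding arrival_order_def by (subst integral_pmf_of_set) auto
  moreover have "\<bar>measure_pmf.expectation arrival_order (reward A p v)\<bar> \<le> (\<Sum>i\<in>UNIV. v $ i)" for A
    using mean_reward_bounds[of v "\<Sum>i\<in>UNIV. v $ i" A p] v by (simp add: member_le_sum)
  ultimately show ?thesis
    by (intro integrable_const_bound[where B = "\<Sum>i\<in>UNIV. v $ i"]) auto
qed

section \<open>The best value and what 1-consistency forces\<close>

lemma best_value_ge: "v $ i \<le> best_value v"
  by (simp add: best_value_def)

lemma best_value_eqI: "(\<And>i. v $ i \<le> v $ j) \<Longrightarrow> best_value v = v $ j"
  unfolding best_value_def by (intro Max_eqI) auto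

lemma positive_in_true_values:
  fixes v :: "real ^ ('n::finite)"
  assumes "\<forall>i. 0 < v $ i"
  shows "v \<in> true_values"
  using assms best_value_ge[of v] less_le_trans by (fastforce simp: true_values_def less_imp_le)

text \<open>With correct predictions the mean reward of every policy is at most
  \<open>p $ a\<close>, yet its integral over \<open>M\<close> equals this bound, so almost every
  policy attains it. Rejecting \<open>a\<close> on first arrival makes that impossible.\<close>

lemma one_consistent_accepts_first:
  fixes p :: "real ^ ('n::finite)"
  assumes M: "online_algorithm M" and cons: "one_consistent M"
    and U: "(UNIV :: 'n set) = {a, b, c}" and d: "a \<noteq> b" "a \<noteq> c" "b \<noteq> c"
    and nn: "0 \<le> p $ b" "0 \<le> p $ c" and less: "p $ b < p $ a" "p $ c < p $ a"
  shows "AE A in M. A p [(a, p $ a)]"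
proof -
  interpret prob_space M
    using M by (simp add: online_algorithm_def)
  let ?g = "\<lambda>A. measure_pmf.expectation arrival_order (reward A p p)"
  note p = le_less_trans[OF nn(1) less(1)] nn less
  have all: "i \<in> {a, b, c}" for i
    using U by auto
  have nonneg: "\<forall>i. 0 \<le> p $ i"
    using p all by (metis less_imp_le insert_iff singletonD)
  have le: "p $ i \<le> p $ a" for i
    using p all by (metis less_imp_le order_refl insert_iff singletonD)
  have bv: "best_value p = p $ a"
    using le by (rule best_value_eqI)
  then have "p \<in> true_values"
    using nonneg p(1) by (simp add: true_values_def)
  then have "expected_reward M p p = p $ a"
    using cons p bv by (auto simp: one_consistent_def competitive_ratio_def)
  then have E: "(\<integral>A. p $ a - ?g A \<partial>M) = 0"
    using mean_reward_integrable[OF M nonneg, of p] by (simp add: expected_reward_def prob_space)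
  have "AE A in M. p $ a - ?g A = 0"
  proof (rule integral_nonneg_eq_0_iff_AE[THEN iffD1, OF _ _ E])
    show "integrable M (\<lambda>A. p $ a - ?g A)"
      using mean_reward_integrable[OF M nonneg, of p] by simp
    show "AE A in M. 0 \<le> p $ a - ?g A"
      using mean_reward_bounds[OF nonneg, of "p $ a"] le by simp
  qed
  then show ?thesis
  proof eventually_elim
    case (elim A)
    have "A p [(a, p $ a)]"
    proof (rule ccontr)
      assume rej: "\<not> A p [(a, p $ a)]"
      \<comment> \<open>After rejecting \<open>a\<close> first, at most \<open>m < p $ a\<close> can
        be gained: two of the six orders fall strictly short and the other four cannot
        compensate.\<close>
      define m where "m = max (p $ b) (p $ c)"
      have "reward A p p [a, b, c] \<le> m" "reward A p p [a, c, b] \<le> m"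
        using reward_Cons_le[of "[b, c]" p m A p a] reward_Cons_le[of "[c, b]" p m A p a] rej p
        by (auto simp: m_def)
      moreover have "reward A p p is \<le> p $ a" for "is"
        using le p by (simp add: reward_le)
      note this[of "[b, a, c]"] this[of "[b, c, a]"] this[of "[c, a, b]"] this[of "[c, b, a]"]
      moreover have "m < p $ a"
        using p by (simp add: m_def)
      ultimately show False
        using elim expectation_arrival_order_3[OF U d, of "reward A p p"] by simp
    qed
    then show ?case .
  qed
qed

text \<open>Split by first arrival, two orders each. If \<open>a\<close> comes first, it is taken
  almost surely; if \<open>b\<close> does, \<open>v $ b\<close> is secured only by accepting it; if
  \<open>s\<close> does, \<open>v $ b\<close> is within reach only after rejecting it. Every other
  outcome pays at most \<open>v $ s\<close>, which the additive term covers.\<close>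

lemma expected_reward_le:
  fixes p v :: "real ^ ('n::finite)"
  assumes M: "online_algorithm M"
    and U: "(UNIV :: 'n set) = {a, s, b}" and d: "a \<noteq> s" "a \<noteq> b" "s \<noteq> b"
    and v: "0 \<le> v $ a" "v $ a \<le> v $ s" "v $ s \<le> v $ b"
    and acc: "AE A in M. A p [(a, v $ a)]"
  shows "expected_reward M p v \<le> v $ s +
    v $ b * (1 + measure M {A \<in> space M. A p [(b, v $ b)]}
               - measure M {A \<in> space M. A p [(s, v $ s)]}) / 3"
proof -
  interpret prob_space M
    using M by (simp add: online_algorithm_def)
  define F where "F i = {A \<in> space M. A p [(i, v $ i)]}" for i
  have [measurable]: "F i \<in> sets M" for i
    using M by (simp add: F_def online_algorithm_def)
  let ?g = "\<lambda>A. measure_pmf.expectation arrival_order (reward A p v)"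
  let ?h = "\<lambda>A. v $ s + v $ b * (1 + indicat_real (F b) A - indicat_real (F s) A) / 3"
  have all: "i \<in> {a, s, b}" for i
    using U by auto
  have nonneg: "\<forall>i. 0 \<le> v $ i"
    using v all by (metis order_trans insert_iff singletonD)
  have int: "integrable M (indicat_real (F i))" for i
    by (simp add: integrable_indicator_iff less_top[symmetric])
  have "AE A in M. ?g A \<le> ?h A"
    using acc AE_space
  proof eventually_elim
    case (elim A)
    have a: "reward A p v [a, s, b] = v $ a" "reward A p v [a, b, s] = v $ a"
      using elim by (simp_all add: reward_def)
    have b: "reward A p v (b # is) \<le> v $ s + v $ b * indicat_real (F b) A"
      if "set is \<subseteq> {a, s}" for "is"
    proof -
      have "\<forall>i \<in> set is. v $ i \<le> v $ s" "0 \<le> v $ s"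
        using that v by auto
      from reward_Cons_le[OF this, of A p b] show ?thesis
        using v elim by (auto simp: F_def indicator_def split: if_splits)
    qed
    have s: "reward A p v (s # is) \<le> v $ s + v $ b * (1 - indicat_real (F s) A)"
      if "set is \<subseteq> {a, b}" for "is"
    proof -
      have "\<forall>i \<in> set is. v $ i \<le> v $ b" "0 \<le> v $ b"
        using that v by auto
      from reward_Cons_le[OF this, of A p s] show ?thesis
        using v elim by (auto simp: F_def indicator_def split: if_splits)
    qed
    \<comment> \<open>Besides the multiples of \<open>v $ b\<close>, the average contains
      \<open>(v $ a + 2 * v $ s) / 3\<close>, which is at most \<open>v $ s\<close>.\<close>
    show ?case
      using expectation_arrival_order_3[OF U d, of "reward A p v"] a v
        b[of "[a, s]"] b[of "[s, a]"] s[of "[a, b]"] s[of "[b, a]"]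
      by (simp add: field_simps)
  qed
  then have "expected_reward M p v \<le> (\<integral>A. ?h A \<partial>M)"
    unfolding expected_reward_def
    by (intro integral_mono_AE mean_reward_integrable M nonneg) (simp_all add: int)
  also have "\<dots> = v $ s + v $ b * (1 + prob (F b) - prob (F s)) / 3"
    by (simp add: int prob_space)
  finally show ?thesis
    by (simp add: F_def)
qed

section \<open>The geometric chain of instances\<close>

text \<open>Histories record identities, so \<open>L ^ Suc k\<close> must sit on the same candidate
  in instance \<open>k\<close>, where it is best, and in instance \<open>Suc k\<close>, where it is
  second best; alternation achieves this. In the type \<open>3\<close> the numeral \<open>3\<close>
  equals \<open>0\<close>, so it differs from \<open>1\<close> and \<open>2\<close>.\<close>

definition chain_candidate :: "nat \<Rightarrow> 3" where
  "chain_candidate k = (if even k then 2 else 3)"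

definition chain_instance :: "real \<Rightarrow> nat \<Rightarrow> real ^ 3" where
  "chain_instance L k = (\<chi> i. if i = 1 then 1 else if i = chain_candidate k then L ^ k else L ^ Suc k)"

text \<open>It agrees with every chain instance at candidate 1; any positive number below 1 in place
  of \<open>1 / 2\<close> would also keep that candidate the strict maximum.\<close>

definition chain_prediction :: "real ^ 3" where
  "chain_prediction = (\<chi> i. if i = 1 then 1 else 1 / 2)"

lemma chain_candidate_distinct:
  "1 \<noteq> chain_candidate k" "1 \<noteq> chain_candidate (Suc k)"
  "chain_candidate k \<noteq> chain_candidate (Suc k)"
  by (auto simp: chain_candidate_def)

lemma UNIV_chain_candidate: "UNIV = {1, chain_candidate k, chain_candidate (Suc k)}"
  using UNIV_3 by (auto simp: chain_candidate_def)

lemma chain_instance_nth: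
  "chain_instance L k $ 1 = 1"
  "chain_instance L k $ chain_candidate k = L ^ k"
  "chain_instance L k $ chain_candidate (Suc k) = L ^ Suc k"
  using chain_candidate_distinct[of k] by (auto simp: chain_instance_def)

lemma chain_instance_ratio:
  fixes M :: "3 policy measure"
  assumes M: "online_algorithm M" and cons: "one_consistent M" and L: "1 < L"
  defines "f \<equiv> \<lambda>k. measure M {A \<in> space M. A chain_prediction [(chain_candidate k, L ^ k)]}"
  shows "competitive_ratio M chain_prediction (chain_instance L k) \<le>
    1 / L + (1 + f (Suc k) - f k) / 3"
proof -
  let ?p = chain_prediction and ?v = "chain_instance L k"
  note U = UNIV_chain_candidate[of k] and d = chain_candidate_distinct[of k]
  \<comment> \<open>For \<open>k = 0\<close> candidate 1 ties with the second best, which the weak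
    inequalities in \<open>expected_reward_le\<close> allow.\<close>
  have pos: "0 < L ^ k" "1 \<le> L ^ k" "L ^ k \<le> L ^ Suc k"
    using L by simp_all
  have "AE A in M. A ?p [(1, ?p $ 1)]"
    by (rule one_consistent_accepts_first[OF M cons U d])
      (use d in \<open>simp_all add: chain_prediction_def\<close>)
  \<comment> \<open>Predicted and true value of candidate 1 coincide, so a policy that sees it first
    cannot tell this instance from the correctly predicted one.\<close>
  then have acc: "AE A in M. A ?p [(1, ?v $ 1)]"
    by (simp add: chain_prediction_def chain_instance_nth)
  have "expected_reward M ?p ?v \<le> L ^ k + L ^ Suc k * (1 + f (Suc k) - f k) / 3"
    using expected_reward_le[OF M U d _ _ _ acc] pos
    unfolding chain_instance_nth f_def by simp
  moreover have "?v $ i \<le> ?v $ chain_candidate (Suc k)" for i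
    using pos d order_trans[OF pos(2,3)] by (auto simp: chain_instance_def)
  then have "best_value ?v = L ^ Suc k"
    using best_value_eqI chain_instance_nth(3) by metis
  ultimately have "competitive_ratio M ?p ?v \<le>
      (L ^ k + L ^ Suc k * (1 + f (Suc k) - f k) / 3) / L ^ Suc k"
    using L by (simp add: competitive_ratio_def divide_right_mono)
  also have "\<dots> = 1 / L + (1 + f (Suc k) - f k) / 3"
    using L by (simp add: field_simps)
  finally show ?thesis .
qed

lemma chain_instance_hard:
  fixes M :: "3 policy measure"
  assumes M: "online_algorithm M" and cons: "one_consistent M"
    and L: "1 < L" "2 / \<delta> \<le> L" and \<delta>: "0 < \<delta>" and m: "1 \<le> real m * \<delta>"
  shows "\<exists>k<m. competitive_ratio M chain_prediction (chain_instance L k) \<le> 1 / 3 + \<delta>"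
proof (rule ccontr)
  assume neg: "\<not> ?thesis"
  interpret prob_space M
    using M by (simp add: online_algorithm_def)
  define f where "f k = prob {A \<in> space M. A chain_prediction [(chain_candidate k, L ^ k)]}" for k
  have "1 / L \<le> \<delta> / 2"
    using L \<delta> by (simp add: field_simps)
  \<comment> \<open>The ratio bound gives \<open>f (Suc k) - f k > 3 * (\<delta> - 1 / L)\<close>,
    which is at least \<open>3 * \<delta> / 2\<close>.\<close>
  then have step: "f k + \<delta> < f (Suc k)" if "k < m" for k
  proof -
    have "1 / 3 + \<delta> < competitive_ratio M chain_prediction (chain_instance L k)"
      using neg that by (simp add: not_le)
    also have "\<dots> \<le> 1 / L + (1 + f (Suc k) - f k) / 3"
      unfolding f_def by (rule chain_instance_ratio[OF M cons L(1)])
    finally show ?thesis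
      using \<open>1 / L \<le> \<delta> / 2\<close> \<delta> by (simp add: field_simps)
  qed
  have "k \<le> m \<Longrightarrow> f 0 + real k * \<delta> \<le> f k" for k
  proof (induction k)
    case (Suc k)
    then show ?case
      using step[of k] by (simp add: algebra_simps)
  qed simp
  \<comment> \<open>The last increment is kept strict: if \<open>real m * \<delta> = 1\<close>, the
    weak bound alone need not contradict \<open>f m \<le> 1\<close>.\<close>
  from this[of "m - 1"] step[of "m - 1"] have "m > 0 \<Longrightarrow> f 0 + real m * \<delta> < f m"
    by (simp add: of_nat_diff algebra_simps)
  moreover have "m > 0"
    using m by (cases m) auto
  moreover have "0 \<le> f 0" "f m \<le> 1"
    by (simp_all add: f_def)
  ultimately show False
    using m by simp
qed

section \<open>Hard instances for all algorithms at once, and robustness\<close>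

lemma hard_instances:
  fixes \<delta> :: real
  assumes \<delta>: "\<delta> > 0"
  shows "\<exists>(p :: real ^ 3) (V :: (real ^ 3) set).
    (\<forall>i. p $ i > 0) \<and> finite V \<and> (\<forall>v \<in> V. \<forall>i. v $ i > 0) \<and> p \<in> V \<and>
    (\<forall>M :: 3 policy measure. online_algorithm M \<and> one_consistent M \<longrightarrow>
       (\<exists>v \<in> V. competitive_ratio M p v \<le> 1 / 3 + \<delta>))"
proof -
  \<comment> \<open>\<open>L\<close> makes \<open>1 / L\<close> at most \<open>\<delta> / 2\<close>,
    and \<open>m\<close> increments of size \<open>\<delta>\<close> exhaust the unit interval. Both
    depend on \<open>\<delta>\<close> alone, so \<open>V\<close> is fixed before
    \<open>M\<close>.\<close>
  define L where "L = 1 + 2 / \<delta>"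
  define m where "m = nat \<lceil>1 / \<delta>\<rceil>"
  \<comment> \<open>The prediction joins \<open>V\<close> to meet \<open>p \<in> V\<close>; the hard
    vector is always found in the chain.\<close>
  define V where "V = insert chain_prediction (chain_instance L ` {..<m})"
  have L: "1 < L" "2 / \<delta> \<le> L"
    using \<delta> by (simp_all add: L_def)
  have "1 / \<delta> \<le> real m"
    unfolding m_def by (rule real_nat_ceiling_ge)
  then have m: "1 \<le> real m * \<delta>"
    using \<delta> by (simp add: field_simps)
  have "\<exists>v \<in> V. competitive_ratio M chain_prediction v \<le> 1 / 3 + \<delta>"
    if "online_algorithm M" "one_consistent M" for M
    using chain_instance_hard[OF that L \<delta> m] by (auto simp: V_def)
  moreover have "\<forall>v \<in> V. \<forall>i. v $ i > 0"
    using L by (auto simp: V_def chain_instance_def chain_prediction_def)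
  ultimately show ?thesis
    by (intro exI[of _ chain_prediction] exI[of _ V]) (simp add: V_def)
qed

lemma not_robust:
  fixes M :: "3 policy measure"
  assumes M: "online_algorithm M" "one_consistent M" and \<rho>: "1 / 3 < \<rho>"
  shows "\<not> robust \<rho> M"
proof
  assume rob: "robust \<rho> M"
  \<comment> \<open>Half of the gap serves as \<open>\<delta>\<close>, which leaves the hard ratio
    strictly below \<open>\<rho>\<close>.\<close>
  have "(\<rho> - 1 / 3) / 2 > 0"
    using \<rho> by simp
  from hard_instances[OF this] M obtain p v :: "real ^ 3"
    where v: "\<forall>i. v $ i > 0" and le: "competitive_ratio M p v \<le> 1 / 3 + (\<rho> - 1 / 3) / 2"
    by meson
  have "\<rho> \<le> competitive_ratio M p v"
    using rob positive_in_true_values[OF v] by (simp add: robust_def)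
  with le \<rho> show False
    by (simp add: field_simps)
qed

theorem theorem1:
  shows "(\<forall>\<delta>::real. \<delta> > 0 \<longrightarrow>
      (\<exists>(p :: real ^ 3) (V :: (real ^ 3) set).
          (\<forall>i. p $ i > 0) \<and> finite V \<and> (\<forall>v \<in> V. \<forall>i. v $ i > 0) \<and> p \<in> V \<and>
          (\<forall>M :: 3 policy measure. online_algorithm M \<and> one_consistent M \<longrightarrow>
             (\<exists>v \<in> V. competitive_ratio M p v \<le> 1 / 3 + \<delta>))) \<and>
      (\<forall>M :: 3 policy measure. online_algorithm M \<and> one_consistent M \<longrightarrow>
          (\<forall>\<rho> > 1 / 3 + \<delta>. \<not> robust \<rho> M))) \<and>
    (\<forall>M :: 3 policy measure. online_algorithm M \<and> one_consistent M \<longrightarrow>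
        \<not> robust (1 / exp 1) M)"
proof -
  \<comment> \<open>The claim about \<open>1 / exp 1\<close> is a case of \<open>not_robust\<close>
    because \<open>e < 3\<close>.\<close>
  have "exp 1 < (3 :: real)"
    using e_less_272 by simp
  then have "1 / 3 < 1 / exp (1 :: real)"
    by (simp add: field_simps)
  then show ?thesis
    by (intro conjI allI impI hard_instances) (simp_all add: not_robust)
qed

end
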